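(* For every $\varepsilon\in(0,1)$ there exists a constant $D=D(\varepsilon)$, depending only on $\varepsilon$, such that for every dimension $n\ge 1$ the following holds: if $U_n\subset\mathbb{R}^n$ is an $n$-dimensional ball of unit volume and $A,B\subset U_n$ are two sets, each of volume $\varepsilon$, then the distance between $A$ and $B$ is at most $D$.
   Context: Volume is $n$-dimensional Lebesgue measure, and sets said to have a volume are measurable. The distance between two sets is $\operatorname{dist}(A,B)=\inf\{|a-b| : a\in A,\ b\in B\}$ with $|\cdot|$ the Euclidean norm. *)

theory Defs
  imports "HOL-Analysis.Analysis"
begin

text \<open>
  The constant of the theorem must be uniform in the dimension, so the dimension is a natural
  number inside the formula and cannot be a type. Points of n-space are therefore functions on
  the index set \<open>{..<n}\<close>, extended by \<open>undefined\<close> elsewhere as in the library's product measures.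
\<close>

definition Rn :: "nat \<Rightarrow> (nat \<Rightarrow> real) set" where
  "Rn n = (\<Pi>\<^sub>E i\<in>{..<n}. UNIV)"

definition lebesgue_n :: "nat \<Rightarrow> (nat \<Rightarrow> real) measure" where
  "lebesgue_n n = completion (\<Pi>\<^sub>M i\<in>{..<n}. lborel)"

definition edist :: "nat \<Rightarrow> (nat \<Rightarrow> real) \<Rightarrow> (nat \<Rightarrow> real) \<Rightarrow> real" where
  "edist n x y = L2_set (\<lambda>i. x i - y i) {..<n}"

definition eball :: "nat \<Rightarrow> (nat \<Rightarrow> real) \<Rightarrow> real \<Rightarrow> (nat \<Rightarrow> real) set" where
  "eball n c r = {x \<in> Rn n. edist n c x < r}"

definition ecball :: "nat \<Rightarrow> (nat \<Rightarrow> real) \<Rightarrow> real \<Rightarrow> (nat \<Rightarrow> real) set" where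
  "ecball n c r = {x \<in> Rn n. edist n c x \<le> r}"

text \<open>A ball may be open or closed.\<close>

definition is_ball :: "nat \<Rightarrow> (nat \<Rightarrow> real) set \<Rightarrow> bool" where
  "is_ball n U \<longleftrightarrow> (\<exists>c\<in>Rn n. \<exists>r>0. U = eball n c r \<or> U = ecball n c r)"

text \<open>The infimum is over a set of reals bounded below by 0; it is meaningful only when both
  sets are nonempty, which positive volume guarantees where it is used.\<close>

definition set_edist :: "nat \<Rightarrow> (nat \<Rightarrow> real) set \<Rightarrow> (nat \<Rightarrow> real) set \<Rightarrow> real" where
  "set_edist n A B = Inf {edist n a b | a b. a \<in> A \<and> b \<in> B}"

lemma space_lebesgue_n: "space (lebesgue_n n) = Rn n"
  by (simp add: lebesgue_n_def Rn_def space_PiM)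

end

theory Submission imports Defs begin

text \<open>
  Let \<open>U\<close> have centre \<open>c\<close> and radius \<open>R\<close>, and let \<open>d\<close> be the distance of \<open>A\<close> and \<open>B\<close>. By the
  parallelogram law every midpoint \<open>(a + b) / 2\<close> lies in the copy of \<open>U\<close> shrunk towards \<open>c\<close> by the
  factor \<open>exp (- d\<^sup>2 / (8 * R\<^sup>2))\<close>, whose square is at least \<open>1 - d\<^sup>2 / (4 * R\<^sup>2)\<close>. The Prekopa-Leindler
  inequality bounds the volume of this copy from below by the geometric mean of the volumes of
  \<open>A\<close> and \<open>B\<close>, so \<open>\<epsilon> \<le> exp (- n * d\<^sup>2 / (8 * R\<^sup>2))\<close>. A ball of unit volume cannot contain
  a cube of side greater than 1, whence \<open>4 * R\<^sup>2 \<le> n\<close> and \<open>d\<^sup>2 \<le> - 2 * ln \<epsilon>\<close>.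
\<close>

section \<open>Brunn-Minkowski inequality for midpoints on the real line\<close>

lemma emeasure_affine_vimage:
  fixes S :: "real set" and c t :: real
  assumes [measurable]: "S \<in> sets borel" and "c \<noteq> 0"
  shows "emeasure lborel S = \<bar>c\<bar> * emeasure lborel ((\<lambda>y. t + c * y) -` S)"
proof -
  have m: "(\<lambda>y. t + c * y) -` S \<in> sets borel"
    using measurable_sets[of "\<lambda>y. t + c * y" borel borel S] by simp
  have "emeasure lborel S = (\<integral>\<^sup>+x. indicator S x \<partial>lborel)"
    by simp
  also have "\<dots> = \<bar>c\<bar> * (\<integral>\<^sup>+y. indicator S (t + c * y) \<partial>lborel)"
    using assms by (intro nn_integral_real_affine) auto
  also have "(\<lambda>y. indicator S (t + c * y) :: ennreal) = indicator ((\<lambda>y. t + c * y) -` S)"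
    by (auto simp: indicator_def)
  finally show ?thesis
    using m by simp
qed

text \<open>The set \<open>K + L\<close> contains \<open>K + min L\<close> and \<open>max K + L\<close>, which share only the point
  \<open>max K + min L\<close>.\<close>

lemma brunn_minkowski_midpoint_compact:
  fixes K L H :: "real set"
  assumes "compact K" "compact L" "K \<noteq> {}" "L \<noteq> {}" and H: "H \<in> sets borel"
    and mid: "\<And>a b. a \<in> K \<Longrightarrow> b \<in> L \<Longrightarrow> (a + b) / 2 \<in> H"
  shows "emeasure lborel K + emeasure lborel L \<le> 2 * emeasure lborel H"
proof -
  obtain k where k: "k \<in> K" "\<And>x. x \<in> K \<Longrightarrow> x \<le> k"
    using compact_attains_sup[of K] assms by blast
  obtain l where l: "l \<in> L" "\<And>x. x \<in> L \<Longrightarrow> l \<le> x"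
    using compact_attains_inf[of L] assms by blast
  \<comment> \<open>These are the halved translates \<open>(K + l) / 2\<close> and
    \<open>(k + L) / 2\<close>, written as preimages so that measurability and the factor 2 come
    from \<open>emeasure_affine_vimage\<close>.\<close>
  define K' where "K' = (\<lambda>y. - l + 2 * y) -` K"
  define L' where "L' = (\<lambda>y. - k + 2 * y) -` L"
  have bor: "K \<in> sets borel" "L \<in> sets borel"
    using assms by (auto intro: borel_compact)
  have K'b: "K' \<in> sets borel" and L'b: "L' \<in> sets borel"
    unfolding K'_def L'_def
    using measurable_sets[of "\<lambda>y. - l + 2 * y" borel borel K]
      measurable_sets[of "\<lambda>y. - k + 2 * y" borel borel L] bor by simp_all
  have eK: "emeasure lborel K = 2 * emeasure lborel K'"
    using emeasure_affine_vimage[OF bor(1), of 2 "-l"] unfolding K'_def by simp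
  have eL: "emeasure lborel L = 2 * emeasure lborel L'"
    using emeasure_affine_vimage[OF bor(2), of 2 "-k"] unfolding L'_def by simp
  have "K' \<subseteq> H"
  proof
    fix y assume "y \<in> K'"
    then have "((- l + 2 * y) + l) / 2 \<in> H"
      unfolding K'_def using l by (intro mid) auto
    then show "y \<in> H" by simp
  qed
  moreover have "L' \<subseteq> H"
  proof
    fix y assume "y \<in> L'"
    then have "(k + (- k + 2 * y)) / 2 \<in> H"
      unfolding L'_def using k by (intro mid) auto
    then show "y \<in> H" by simp
  qed
  moreover have "K' \<inter> (L' - {(k + l) / 2}) = {}"
  proof -
    have "y = (k + l) / 2" if "y \<in> K'" "y \<in> L'" for y
      using k(2)[of "- l + 2 * y"] l(2)[of "- k + 2 * y"] that unfolding K'_def L'_def by simp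
    then show ?thesis by blast
  qed
  moreover have "emeasure lborel (L' - {(k + l) / 2}) = emeasure lborel L'"
    using L'b by (intro emeasure_Diff_null_set) auto
  ultimately have "emeasure lborel K' + emeasure lborel L' \<le> emeasure lborel H"
    using plus_emeasure[of K' lborel "L' - {(k + l) / 2}"] K'b L'b H
      emeasure_mono[of "K' \<union> (L' - {(k + l) / 2})" H lborel] by auto
  then show ?thesis
    unfolding eK eL distrib_left[symmetric] by (intro mult_left_mono) auto
qed

text \<open>Inner regularity is applied to a finite measure: some bounded part of \<open>A\<close>
  already has measure above \<open>r\<close>, and Lebesgue measure is restricted to the interval
  containing that part.\<close>

lemma lborel_inner_compact:
  fixes A :: "real set"
  assumes A: "A \<in> sets borel" and r: "r < emeasure lborel A"
  obtains K where "compact K" "K \<subseteq> A" "r < emeasure lborel K"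
proof -
  define B where "B n = A \<inter> {- real n..real n}" for n :: nat
  have inc: "incseq B"
    unfolding incseq_def B_def by auto
  have un: "(\<Union>n. B n) = A"
  proof -
    have "\<exists>n. x \<in> {- real n..real n}" for x :: real
      using real_arch_simple[of "\<bar>x\<bar>"] by (auto simp: abs_le_iff) (metis minus_le_iff)
    then show ?thesis unfolding B_def by auto
  qed
  have Bb: "B n \<in> sets borel" for n
    unfolding B_def using A by auto
  have "(SUP n. emeasure lborel (B n)) = emeasure lborel A"
    using SUP_emeasure_incseq[of B lborel] inc Bb un by auto
  then obtain n where n: "r < emeasure lborel (B n)"
    using r by (metis less_SUP_iff)
  define M where "M = density lborel (indicator {- real n..real n})"
  have eM: "emeasure M X = emeasure lborel (X \<inter> {- real n..real n})" if "X \<in> sets borel" for X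
    unfolding M_def using that by (subst emeasure_density) (auto simp: indicator_inter_arith[symmetric] Int_commute mult.commute)
  have sM: "sets M = sets borel" and "space M = UNIV"
    by (simp_all add: M_def)
  then have "emeasure M (space M) \<noteq> \<infinity>"
    by (simp add: eM)
  then have "emeasure M A = (SUP K \<in> {K. K \<subseteq> A \<and> compact K}. emeasure M K)"
    using inner_regular[of M A] sM A by auto
  then obtain K where K: "K \<subseteq> A" "compact K" "r < emeasure M K"
    using n eM[OF A] unfolding B_def by (auto simp: less_SUP_iff)
  show thesis
  proof
    \<comment> \<open>\<open>M\<close> ignores everything outside the interval, so cutting
      \<open>K\<close> down to it turns \<open>M\<close>-measure into Lebesgue measure.\<close>
    show "compact (K \<inter> {- real n..real n})" using K by (simp add: compact_Int)
    show "K \<inter> {- real n..real n} \<subseteq> A" using K by auto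
    show "r < emeasure lborel (K \<inter> {- real n..real n})"
      using K eM[of K] by (simp add: borel_compact)
  qed
qed

text \<open>Inner regularity carries the compact case over to Borel sets. \<open>H\<close> is any
  Borel set containing the midpoints, because the set of midpoints of two Borel sets need not itself
  be Borel.\<close>

lemma brunn_minkowski_midpoint_real:
  fixes A B H :: "real set"
  assumes A: "A \<in> sets borel" "A \<noteq> {}" and B: "B \<in> sets borel" "B \<noteq> {}" and H: "H \<in> sets borel"
    and mid: "\<And>a b. a \<in> A \<Longrightarrow> b \<in> B \<Longrightarrow> (a + b) / 2 \<in> H"
  shows "emeasure lborel A + emeasure lborel B \<le> 2 * emeasure lborel H"
proof -
  have inner: "emeasure lborel S = (SUP K \<in> {K. K \<subseteq> S \<and> compact K \<and> K \<noteq> {}}. emeasure lborel K)"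
    if S: "S \<in> sets borel" "S \<noteq> {}" for S :: "real set"
  proof (rule antisym)
    show "emeasure lborel S \<le> (SUP K \<in> {K. K \<subseteq> S \<and> compact K \<and> K \<noteq> {}}. emeasure lborel K)"
    proof (rule dense_le)
      fix r assume "r < emeasure lborel S"
      with S obtain K where "compact K" "K \<subseteq> S" "r < emeasure lborel K"
        using lborel_inner_compact by blast
      moreover from this have "K \<noteq> {}" by auto
      ultimately show "r \<le> (SUP K \<in> {K. K \<subseteq> S \<and> compact K \<and> K \<noteq> {}}. emeasure lborel K)"
        by (intro SUP_upper2[of K]) auto
    qed
  qed (use S in \<open>auto intro!: SUP_least emeasure_mono\<close>)
  \<comment> \<open>A supremum moves out of a sum only when its index set is nonempty; singletons
    provide a member.\<close>
  have ne: "{K. K \<subseteq> S \<and> compact K \<and> K \<noteq> {}} \<noteq> {}" if "S \<noteq> {}" for S :: "real set"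
  proof -
    obtain x where "x \<in> S" using \<open>S \<noteq> {}\<close> by auto
    then have "{x} \<in> {K. K \<subseteq> S \<and> compact K \<and> K \<noteq> {}}" by auto
    then show ?thesis by blast
  qed
  have "emeasure lborel K + emeasure lborel L \<le> 2 * emeasure lborel H"
    if "K \<subseteq> A" "compact K" "K \<noteq> {}" "L \<subseteq> B" "compact L" "L \<noteq> {}" for K L
    using that H mid by (intro brunn_minkowski_midpoint_compact) auto
  then have "emeasure lborel K + emeasure lborel B \<le> 2 * emeasure lborel H"
    if "K \<subseteq> A" "compact K" "K \<noteq> {}" for K
    unfolding inner[OF B] ennreal_SUP_add_right[OF ne[OF B(2)]]
    by (intro SUP_least) (use that in blast)
  then show ?thesis
    unfolding inner[OF A] ennreal_SUP_add_left[OF ne[OF A(2)], symmetric]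
    by (intro SUP_least) blast
qed

section \<open>Prekopa-Leindler inequality on the real line\<close>

text \<open>The value \<open>h x\<close> is the length of the set of \<open>t \<ge> 0\<close> below
  it, and Tonelli swaps the two integrals. The factor \<open>indicator {0..} t\<close> matters
  because \<open>ennreal t\<close> is 0 for every negative \<open>t\<close>.\<close>

lemma nn_integral_layer_cake:
  fixes h :: "real \<Rightarrow> ennreal"
  assumes [measurable]: "h \<in> borel_measurable borel"
  shows "(\<integral>\<^sup>+x. h x \<partial>lborel) = (\<integral>\<^sup>+t. emeasure lborel {x. ennreal t < h x} * indicator {0..} t \<partial>lborel)"
proof -
  have "(\<integral>\<^sup>+x. h x \<partial>lborel) = (\<integral>\<^sup>+x. (\<integral>\<^sup>+t. indicator {x. ennreal t < h x} x * indicator {0..} t \<partial>lborel) \<partial>lborel)"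
  proof (rule nn_integral_cong)
    fix x
    have eq: "indicator {x. ennreal t < h x} x * indicator {0..} t = (indicator {t. 0 \<le> t \<and> ennreal t < h x} t :: ennreal)" for t
      by (auto simp: indicator_def)
    have "emeasure lborel {t. 0 \<le> t \<and> ennreal t < h x} = h x"
    proof (cases "h x")
      case (real r)
      then have "{t. 0 \<le> t \<and> ennreal t < h x} = {0..<r}"
        by (auto simp: ennreal_less_iff)
      with real show ?thesis by simp
    next
      case top
      then have "{t. 0 \<le> t \<and> ennreal t < h x} = {0..}" by auto
      moreover have "emeasure lborel {0::real..} = top"
      proof -
        have "(SUP n. of_nat n) \<le> emeasure lborel {0::real..}"
        proof (rule SUP_least)
          fix n :: nat
          have "of_nat n = emeasure lborel {0..real n}"
            by (simp add: ennreal_of_nat_eq_real_of_nat)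
          also have "\<dots> \<le> emeasure lborel {0::real..}" by (intro emeasure_mono) auto
          finally show "of_nat n \<le> emeasure lborel {0::real..}" .
        qed
        then show ?thesis by (simp add: ennreal_SUP_of_nat_eq_top top_unique)
      qed
      ultimately show ?thesis using top by simp
    qed
    then show "h x = (\<integral>\<^sup>+t. indicator {x. ennreal t < h x} x * indicator {0..} t \<partial>lborel)"
      unfolding eq by (subst nn_integral_indicator) auto
  qed
  also have "\<dots> = (\<integral>\<^sup>+t. (\<integral>\<^sup>+x. indicator {x. ennreal t < h x} x * indicator {0..} t \<partial>lborel) \<partial>lborel)"
  proof -
    have [measurable]: "Measurable.pred (borel \<Otimes>\<^sub>M borel) (\<lambda>z. ennreal (snd z) < h (fst z))" by measurable
    have "(\<lambda>(x,t). indicator {x. ennreal t < h x} x * indicator {0..} t :: ennreal) \<in> borel_measurable (borel \<Otimes>\<^sub>M borel)"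
      unfolding indicator_def case_prod_beta by measurable
    then show ?thesis
      by (intro lborel_pair.Fubini') (simp add: measurable_cong_sets[OF sets_pair_measure_cong[OF sets_lborel sets_lborel]])
  qed
  also have "\<dots> = (\<integral>\<^sup>+t. emeasure lborel {x. ennreal t < h x} * indicator {0..} t \<partial>lborel)"
    by (intro nn_integral_cong) (subst nn_integral_multc, auto)
  finally show ?thesis .
qed

text \<open>Equal suprema make the superlevel sets of \<open>f\<close> and \<open>g\<close> nonempty
  for the same levels, those below 1, and empty from 1 on. Brunn-Minkowski holds at each level, and
  the layer cake formula integrates it over all levels.\<close>

lemma prekopa_leindler_midpoint_normalised:
  fixes f g h :: "real \<Rightarrow> ennreal"
  assumes f [measurable]: "f \<in> borel_measurable borel" and g [measurable]: "g \<in> borel_measurable borel"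
    and h [measurable]: "h \<in> borel_measurable borel"
    and sup: "(SUP x. f x) = 1" "(SUP x. g x) = 1"
    and le: "\<And>x y. f x * g y \<le> (h ((x + y) / 2))\<^sup>2"
  shows "(\<integral>\<^sup>+x. f x \<partial>lborel) + (\<integral>\<^sup>+x. g x \<partial>lborel) \<le> 2 * (\<integral>\<^sup>+x. h x \<partial>lborel)"
proof -
  have level: "emeasure lborel {x. ennreal t < f x} + emeasure lborel {x. ennreal t < g x}
    \<le> 2 * emeasure lborel {x. ennreal t < h x}" if t: "0 \<le> t" for t
  proof (cases "t < 1")
    case True
    then have t1: "ennreal t < 1" using t by simp
    have "{x. ennreal t < f x} \<noteq> {}"
      using t1 unfolding sup(1)[symmetric] by (auto simp: less_SUP_iff)
    moreover have "{x. ennreal t < g x} \<noteq> {}"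
      using t1 unfolding sup(2)[symmetric] by (auto simp: less_SUP_iff)
    moreover have "(a + b) / 2 \<in> {x. ennreal t < h x}"
      if "a \<in> {x. ennreal t < f x}" "b \<in> {x. ennreal t < g x}" for a b
    proof -
      have "ennreal t < min (f a) (g b)" using that by simp
      \<comment> \<open>A finite value strictly in between keeps the inequality of squares strict
        and within the reals.\<close>
      then obtain r where r: "ennreal t < r" "r < min (f a) (g b)" using dense by blast
      then have "r < top" by (intro order.strict_trans2[OF r(2)] top_greatest)
      then obtain p where p: "r = ennreal p" "0 \<le> p" by (cases r) auto
      have "(ennreal t)\<^sup>2 < (ennreal p)\<^sup>2"
        using r p t by (simp add: ennreal_power ennreal_less_iff power_strict_mono)
      also have "\<dots> \<le> f a * g b"
        unfolding power2_eq_square using r p by (intro mult_mono) auto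
      also have "\<dots> \<le> (h ((a + b) / 2))\<^sup>2" by (rule le)
      finally show ?thesis
        using power_mono[of "h ((a + b) / 2)" "ennreal t" 2] by (auto simp: not_less[symmetric])
    qed
    ultimately show ?thesis
      by (intro brunn_minkowski_midpoint_real) auto
  next
    case False
    then have "1 \<le> ennreal t" by simp
    moreover have "f x \<le> 1" "g x \<le> 1" for x
      using SUP_upper[of x UNIV f] SUP_upper[of x UNIV g] unfolding sup by auto
    ultimately have "f x \<le> ennreal t" "g x \<le> ennreal t" for x
      by (blast intro: order_trans)+
    then have "{x. ennreal t < f x} = {}" "{x. ennreal t < g x} = {}"
      by (auto simp: not_less[symmetric])
    then show ?thesis by simp
  qed
  \<comment> \<open>Written as an integral over \<open>x\<close> of a jointly measurable function,
    the level measure is measurable in \<open>t\<close>.\<close>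
  have meas: "(\<lambda>t. emeasure lborel {x. ennreal t < k x} * indicator {0..} t) \<in> borel_measurable lborel"
    if [measurable]: "k \<in> borel_measurable borel" for k :: "real \<Rightarrow> ennreal"
  proof -
    have "(\<lambda>t. \<integral>\<^sup>+x. of_bool (ennreal t < k x) \<partial>lborel) \<in> borel_measurable lborel"
      by measurable
    also have "(\<lambda>t. \<integral>\<^sup>+x. of_bool (ennreal t < k x) \<partial>lborel) = (\<lambda>t. emeasure lborel {x. ennreal t < k x})"
    proof
      fix t
      have "of_bool (ennreal t < k x) = (indicator {x. ennreal t < k x} x :: ennreal)" for x
        by (simp add: indicator_def)
      then show "(\<integral>\<^sup>+x. of_bool (ennreal t < k x) \<partial>lborel) = emeasure lborel {x. ennreal t < k x}"
        by simp
    qed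
    finally show ?thesis by measurable
  qed
  show ?thesis
    unfolding nn_integral_layer_cake[OF f] nn_integral_layer_cake[OF g] nn_integral_layer_cake[OF h]
      nn_integral_add[OF meas[OF f] meas[OF g], symmetric] nn_integral_cmult[OF meas[OF h], symmetric]
    by (intro nn_integral_mono) (auto simp: indicator_def level)
qed

text \<open>This is \<open>4 * (x * y) \<le> (x + y)\<^sup>2\<close>. It turns the additive
  conclusion of the normalised case into the multiplicative one.\<close>

lemma ennreal_arith_geo_mean:
  fixes x y z :: ennreal
  assumes "x + y \<le> 2 * z"
  shows "x * y \<le> z\<^sup>2"
proof (cases z)
  case (real c)
  then have "2 * z = ennreal (2 * c)" by (simp add: ennreal_mult'')
  with assms have "x + y \<le> ennreal (2 * c)" by simp
  then have "x + y < top" by (rule le_less_trans) simp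
  then obtain a b where ab: "x = ennreal a" "y = ennreal b" "0 \<le> a" "0 \<le> b"
    by (cases x; cases y) auto
  have "a + b \<le> 2 * c"
    using assms real ab by (simp add: ennreal_plus[symmetric] ennreal_mult''[symmetric] 
      ennreal_numeral[symmetric] del: ennreal_plus ennreal_numeral)
  then have "(a + b)\<^sup>2 \<le> (2 * c)\<^sup>2"
    using ab by (intro power_mono) auto
  moreover have "4 * (a * b) \<le> (a + b)\<^sup>2"
    using zero_le_power2[of "a - b"] by (simp add: power2_eq_square algebra_simps)
  ultimately have "a * b \<le> c\<^sup>2" by (simp add: power_mult_distrib)
  with real ab show ?thesis
    by (simp add: ennreal_mult''[symmetric] ennreal_power)
next
  case top
  then show ?thesis by (simp add: power2_eq_square)
qed

text \<open>Boundedness makes the suprema \<open>a\<close> and \<open>b\<close> of \<open>f\<close>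
  and \<open>g\<close> finite. If neither is 0, dividing by them reduces the claim to the normalised
  case; otherwise the left side is 0.\<close>

lemma prekopa_leindler_midpoint_bounded:
  fixes f g h :: "real \<Rightarrow> ennreal"
  assumes f [measurable]: "f \<in> borel_measurable borel" and g [measurable]: "g \<in> borel_measurable borel"
    and h [measurable]: "h \<in> borel_measurable borel"
    and bdd: "\<And>x. f x \<le> ennreal c" "\<And>x. g x \<le> ennreal c"
    and le: "\<And>x y. f x * g y \<le> (h ((x + y) / 2))\<^sup>2"
  shows "(\<integral>\<^sup>+x. f x \<partial>lborel) * (\<integral>\<^sup>+x. g x \<partial>lborel) \<le> (\<integral>\<^sup>+x. h x \<partial>lborel)\<^sup>2"
proof -
  have fin: "(SUP x. f x) < top" "(SUP x. g x) < top"
    using SUP_least[of UNIV f, OF bdd(1)] SUP_least[of UNIV g, OF bdd(2)]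
    by (auto intro: le_less_trans)
  show ?thesis
  proof (cases "(SUP x. f x) = 0 \<or> (SUP x. g x) = 0")
    case True
    then have "(\<forall>x. f x = 0) \<or> (\<forall>x. g x = 0)"
      by (metis SUP_upper UNIV_I le_zero_eq)
    then show ?thesis by auto
  next
    case False
    obtain a where a: "(SUP x. f x) = ennreal a" "0 < a"
      using fin False by (cases "SUP x. f x") (auto simp: less_le)
    obtain b where b: "(SUP x. g x) = ennreal b" "0 < b"
      using fin False by (cases "SUP x. g x") (auto simp: less_le)
    \<comment> \<open>The hypothesis survives rescaling when the factor for \<open>h\<close> is the
      geometric mean of \<open>1 / a\<close> and \<open>1 / b\<close>; the common factor
      \<open>s\<^sup>2\<close> cancels at the end.\<close>
    define s where "s = 1 / sqrt (a * b)"
    have s: "0 \<le> s" "s\<^sup>2 = (1 / a) * (1 / b)"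
      using a b by (auto simp: s_def power_divide)
    have es: "ennreal (s\<^sup>2) = ennreal (1 / a) * ennreal (1 / b)" "(ennreal s)\<^sup>2 = ennreal (s\<^sup>2)"
      using a b s(1) by (simp_all only: s(2) ennreal_mult ennreal_power divide_nonneg_pos zero_le_one)
    have "(\<integral>\<^sup>+x. ennreal (1 / a) * f x \<partial>lborel) + (\<integral>\<^sup>+x. ennreal (1 / b) * g x \<partial>lborel)
      \<le> 2 * (\<integral>\<^sup>+x. ennreal s * h x \<partial>lborel)"
    proof (intro prekopa_leindler_midpoint_normalised)
      show "(SUP x. ennreal (1 / a) * f x) = 1" "(SUP x. ennreal (1 / b) * g x) = 1"
        using a b by (simp_all add: SUP_mult_left_ennreal[symmetric] ennreal_mult''[symmetric] del: ennreal_1)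
      fix x y
      have "ennreal (1 / a) * f x * (ennreal (1 / b) * g y) = ennreal (s\<^sup>2) * (f x * g y)"
        unfolding es(1) by (simp only: mult_ac)
      also have "\<dots> \<le> ennreal (s\<^sup>2) * (h ((x + y) / 2))\<^sup>2"
        by (intro mult_left_mono le) auto
      also have "\<dots> = (ennreal s * h ((x + y) / 2))\<^sup>2"
        by (simp only: power_mult_distrib es(2))
      finally show "ennreal (1 / a) * f x * (ennreal (1 / b) * g y) \<le> (ennreal s * h ((x + y) / 2))\<^sup>2" .
    qed auto
    then have "ennreal (1 / a) * integral\<^sup>N lborel f * (ennreal (1 / b) * integral\<^sup>N lborel g)
      \<le> (ennreal s * integral\<^sup>N lborel h)\<^sup>2"
      by (subst (asm) (1 2 3) nn_integral_cmult) (auto intro: ennreal_arith_geo_mean)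
    then have "ennreal (s\<^sup>2) * (integral\<^sup>N lborel f * integral\<^sup>N lborel g) \<le> ennreal (s\<^sup>2) * (integral\<^sup>N lborel h)\<^sup>2"
      unfolding power_mult_distrib es by (simp only: mult_ac)
    moreover have "s\<^sup>2 \<noteq> 0" using a b s by simp
    ultimately show ?thesis
      by (subst (asm) ennreal_mult_le_mult_iff) auto
  qed
qed

lemma prekopa_leindler_midpoint_real:
  fixes f g h :: "real \<Rightarrow> ennreal"
  assumes f [measurable]: "f \<in> borel_measurable borel" and g [measurable]: "g \<in> borel_measurable borel"
    and h [measurable]: "h \<in> borel_measurable borel"
    and le: "\<And>x y. f x * g y \<le> (h ((x + y) / 2))\<^sup>2"
  shows "(\<integral>\<^sup>+x. f x \<partial>lborel) * (\<integral>\<^sup>+x. g x \<partial>lborel) \<le> (\<integral>\<^sup>+x. h x \<partial>lborel)\<^sup>2"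
proof -
  have trunc: "(\<integral>\<^sup>+x. k x \<partial>lborel) = (SUP n. \<integral>\<^sup>+x. min (k x) (of_nat n) \<partial>lborel)"
    if [measurable]: "k \<in> borel_measurable borel" for k :: "real \<Rightarrow> ennreal"
  proof -
    have "(SUP n. min r (of_nat n)) = r" for r :: ennreal
      by (simp add: inf_min[symmetric] inf_SUP[symmetric] ennreal_SUP_of_nat_eq_top)
    then have "(\<integral>\<^sup>+x. k x \<partial>lborel) = (\<integral>\<^sup>+x. (SUP n. min (k x) (of_nat n)) \<partial>lborel)"
      by simp
    also have "\<dots> = (SUP n. \<integral>\<^sup>+x. min (k x) (of_nat n) \<partial>lborel)"
      by (intro nn_integral_monotone_convergence_SUP)
        (auto simp: incseq_def le_fun_def min.coboundedI2)
    finally show ?thesis .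
  qed
  \<comment> \<open>The truncation levels are independent so that the two suprema can be taken
    separately; \<open>max m n\<close> is a common bound.\<close>
  have "(\<integral>\<^sup>+x. min (f x) (of_nat m) \<partial>lborel) * (\<integral>\<^sup>+x. min (g x) (of_nat n) \<partial>lborel) \<le> (\<integral>\<^sup>+x. h x \<partial>lborel)\<^sup>2"
    for m n :: nat
  proof (rule prekopa_leindler_midpoint_bounded)
    show "min (f x) (of_nat m) \<le> ennreal (real (max m n))" "min (g x) (of_nat n) \<le> ennreal (real (max m n))" for x
      by (auto simp: ennreal_of_nat_eq_real_of_nat min.coboundedI2)
    show "min (f x) (of_nat m) * min (g y) (of_nat n) \<le> (h ((x + y) / 2))\<^sup>2" for x y
      by (rule order_trans[OF mult_mono le]) auto
  qed auto
  then show ?thesis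
    unfolding trunc[OF f] trunc[OF g] SUP_mult_left_ennreal SUP_mult_right_ennreal
    by (intro SUP_least)
qed

section \<open>Prekopa-Leindler inequality and scaling in finite products\<close>

text \<open>Induction over the coordinates: integrating \<open>f\<close>, \<open>g\<close>,
  \<open>h\<close> over one coordinate preserves the hypothesis, by the one-dimensional inequality.
  The restriction to \<open>I\<close> keeps midpoints inside the product space.\<close>

theorem prekopa_leindler_midpoint:
  fixes f g h :: "('i \<Rightarrow> real) \<Rightarrow> ennreal"
  assumes "finite I"
    and "f \<in> borel_measurable (\<Pi>\<^sub>M i\<in>I. lborel)" "g \<in> borel_measurable (\<Pi>\<^sub>M i\<in>I. lborel)"
      "h \<in> borel_measurable (\<Pi>\<^sub>M i\<in>I. lborel)"
    and "\<And>x y. x \<in> (\<Pi>\<^sub>E i\<in>I. UNIV) \<Longrightarrow> y \<in> (\<Pi>\<^sub>E i\<in>I. UNIV) \<Longrightarrow>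
      f x * g y \<le> (h (\<lambda>i\<in>I. (x i + y i) / 2))\<^sup>2"
  shows "(\<integral>\<^sup>+x. f x \<partial>(\<Pi>\<^sub>M i\<in>I. lborel)) * (\<integral>\<^sup>+x. g x \<partial>(\<Pi>\<^sub>M i\<in>I. lborel))
    \<le> (\<integral>\<^sup>+x. h x \<partial>(\<Pi>\<^sub>M i\<in>I. lborel))\<^sup>2"
  using assms
proof (induction I arbitrary: f g h rule: finite_induct)
  case empty
  interpret product_sigma_finite "\<lambda>_. lborel :: real measure" by standard
  show ?case
    \<comment> \<open>The empty product is a single point of mass 1, where the hypothesis is the
      claim.\<close>
    using empty(4)[of "\<lambda>_. undefined" "\<lambda>_. undefined"] by (simp add: nn_integral_empty restrict_def)
next
  case (insert i I)
  interpret product_sigma_finite "\<lambda>_. lborel :: real measure" by standard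
  note [measurable] = insert.prems(1-3)
  have slice: "(\<lambda>x. \<integral>\<^sup>+t. k (x(i := t)) \<partial>lborel) \<in> borel_measurable (\<Pi>\<^sub>M i\<in>I. lborel)"
    if [measurable]: "k \<in> borel_measurable (\<Pi>\<^sub>M i\<in>insert i I. lborel)" for k :: "('i \<Rightarrow> real) \<Rightarrow> ennreal"
    by measurable
  \<comment> \<open>This is the hypothesis of the induction for the partial integrals over
    coordinate \<open>i\<close>.\<close>
  have "(\<integral>\<^sup>+t. f (x(i := t)) \<partial>lborel) * (\<integral>\<^sup>+t. g (y(i := t)) \<partial>lborel)
      \<le> (\<integral>\<^sup>+t. h ((\<lambda>j\<in>I. (x j + y j) / 2)(i := t)) \<partial>lborel)\<^sup>2"
    if xy: "x \<in> (\<Pi>\<^sub>E i\<in>I. UNIV)" "y \<in> (\<Pi>\<^sub>E i\<in>I. UNIV)" for x y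
  proof (rule prekopa_leindler_midpoint_real)
    have sec: "(\<lambda>t. k (z(i := t))) \<in> borel_measurable borel"
      if [measurable]: "k \<in> borel_measurable (\<Pi>\<^sub>M i\<in>insert i I. lborel)" and "z \<in> (\<Pi>\<^sub>E i\<in>I. UNIV)"
      for k :: "('i \<Rightarrow> real) \<Rightarrow> ennreal" and z
    proof -
      have "z \<in> space (\<Pi>\<^sub>M i\<in>I. lborel)" using that by (simp add: space_PiM)
      then have "(\<lambda>t. k (z(i := t))) \<in> borel_measurable lborel" by measurable
      then show ?thesis by simp
    qed
    show "(\<lambda>t. f (x(i := t))) \<in> borel_measurable borel" "(\<lambda>t. g (y(i := t))) \<in> borel_measurable borel"
      "(\<lambda>t. h ((\<lambda>j\<in>I. (x j + y j) / 2)(i := t))) \<in> borel_measurable borel"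
      using xy insert.prems by (auto intro!: sec)
    fix s t :: real
    have "f (x(i := s)) * g (y(i := t)) \<le> (h (\<lambda>j\<in>insert i I. ((x(i := s)) j + (y(i := t)) j) / 2))\<^sup>2"
      using xy by (intro insert.prems(4)) (auto simp: PiE_iff extensional_def)
    also have "(\<lambda>j\<in>insert i I. ((x(i := s)) j + (y(i := t)) j) / 2) = (\<lambda>j\<in>I. (x j + y j) / 2)(i := (s + t) / 2)"
      using insert.hyps by (auto simp: fun_eq_iff)
    finally show "f (x(i := s)) * g (y(i := t)) \<le> (h ((\<lambda>j\<in>I. (x j + y j) / 2)(i := (s + t) / 2)))\<^sup>2" .
  qed
  then show ?case
    unfolding product_nn_integral_insert[OF insert.hyps insert.prems(1)]
      product_nn_integral_insert[OF insert.hyps insert.prems(2)]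
      product_nn_integral_insert[OF insert.hyps insert.prems(3)]
    by (intro insert.IH slice insert.prems)
qed

text \<open>Fubini splits off one coordinate at a time, and the substitution in each contributes a
  factor \<open>c\<close>. The lemma yields the volume of the shrunk ball.\<close>

lemma nn_integral_PiM_affine:
  fixes f :: "('i \<Rightarrow> real) \<Rightarrow> ennreal" and t :: "'i \<Rightarrow> real" and c :: real
  assumes "finite I" and "0 < c" and "f \<in> borel_measurable (\<Pi>\<^sub>M i\<in>I. lborel)"
  shows "(\<integral>\<^sup>+x. f x \<partial>(\<Pi>\<^sub>M i\<in>I. lborel))
    = ennreal (c ^ card I) * (\<integral>\<^sup>+x. f (\<lambda>i\<in>I. t i + c * x i) \<partial>(\<Pi>\<^sub>M i\<in>I. lborel))"
  using assms(1,3)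
proof (induction I arbitrary: f rule: finite_induct)
  case empty
  interpret product_sigma_finite "\<lambda>_. lborel :: real measure" by standard
  show ?case
    by (simp add: nn_integral_empty restrict_def del: nn_integral_const)
next
  case (insert i I)
  interpret product_sigma_finite "\<lambda>_. lborel :: real measure" by standard
  note [measurable] = insert.prems
  let ?M = "\<Pi>\<^sub>M i\<in>I. lborel :: real measure"
  define T where "T x = (\<lambda>i\<in>I. t i + c * x i)" for x :: "'i \<Rightarrow> real"
  have T [measurable]: "T \<in> ?M \<rightarrow>\<^sub>M ?M"
    unfolding T_def by measurable
  have [measurable]: "(\<lambda>x. f (\<lambda>j\<in>insert i I. t j + c * x j)) \<in> borel_measurable (\<Pi>\<^sub>M i\<in>insert i I. lborel)"
    by measurable
  have "(\<integral>\<^sup>+x. f x \<partial>(\<Pi>\<^sub>M i\<in>insert i I. lborel)) = (\<integral>\<^sup>+x. (\<integral>\<^sup>+s. f (x(i := s)) \<partial>lborel) \<partial>?M)"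
    by (rule product_nn_integral_insert) (use insert in auto)
  also have "\<dots> = ennreal (c ^ card I) * (\<integral>\<^sup>+x. (\<integral>\<^sup>+s. f ((T x)(i := s)) \<partial>lborel) \<partial>?M)"
    unfolding T_def by (rule insert.IH) measurable
  also have "(\<integral>\<^sup>+x. (\<integral>\<^sup>+s. f ((T x)(i := s)) \<partial>lborel) \<partial>?M)
    = (\<integral>\<^sup>+x. ennreal c * (\<integral>\<^sup>+s. f ((T x)(i := t i + c * s)) \<partial>lborel) \<partial>?M)"
  proof (rule nn_integral_cong)
    fix x assume "x \<in> space ?M"
    then have "T x \<in> space ?M" by (rule measurable_space[OF T])
    then have "(\<lambda>s. f ((T x)(i := s))) \<in> borel_measurable lborel" by measurable
    then show "(\<integral>\<^sup>+s. f ((T x)(i := s)) \<partial>lborel) = ennreal c * (\<integral>\<^sup>+s. f ((T x)(i := t i + c * s)) \<partial>lborel)"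
      using nn_integral_real_affine[of "\<lambda>s. f ((T x)(i := s))" c "t i"] \<open>0 < c\<close> by simp
  qed
  also have "\<dots> = ennreal c * (\<integral>\<^sup>+x. (\<integral>\<^sup>+s. f ((T x)(i := t i + c * s)) \<partial>lborel) \<partial>?M)"
    by (rule nn_integral_cmult) measurable
  also have "(\<integral>\<^sup>+x. (\<integral>\<^sup>+s. f ((T x)(i := t i + c * s)) \<partial>lborel) \<partial>?M)
    = (\<integral>\<^sup>+x. (\<integral>\<^sup>+s. f (\<lambda>j\<in>insert i I. t j + c * (x(i := s)) j) \<partial>lborel) \<partial>?M)"
  proof -
    have "(T x)(i := t i + c * s) = (\<lambda>j\<in>insert i I. t j + c * (x(i := s)) j)" for x s
      using insert.hyps by (auto simp: fun_eq_iff T_def)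
    then show ?thesis by simp
  qed
  also have "\<dots> = (\<integral>\<^sup>+x. f (\<lambda>j\<in>insert i I. t j + c * x j) \<partial>(\<Pi>\<^sub>M i\<in>insert i I. lborel))"
    by (rule product_nn_integral_insert[symmetric]) (use insert in auto)
  also have "ennreal (c ^ card I) * (ennreal c * X) = ennreal (c ^ card (insert i I)) * X" for X
    using insert.hyps \<open>0 < c\<close> by (simp add: ennreal_mult mult_ac)
  finally show ?case .
qed

section \<open>Euclidean distance and balls\<close>

lemma measurable_edist [measurable]: "edist n c \<in> borel_measurable (\<Pi>\<^sub>M i\<in>{..<n}. lborel)"
  unfolding edist_def[abs_def] L2_set_def by measurable

lemma is_ball_sets:
  assumes "is_ball n U"
  shows "U \<in> sets (\<Pi>\<^sub>M i\<in>{..<n}. lborel)"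
proof -
  have "Rn n = space (\<Pi>\<^sub>M i\<in>{..<n}. lborel :: real measure)"
    by (simp add: Rn_def space_PiM)
  then have "eball n c r \<in> sets (\<Pi>\<^sub>M i\<in>{..<n}. lborel)" "ecball n c r \<in> sets (\<Pi>\<^sub>M i\<in>{..<n}. lborel)" for c r
    unfolding eball_def ecball_def by simp_all
  then show ?thesis
    using assms unfolding is_ball_def by auto
qed

lemma edist_power2: "(edist n x y)\<^sup>2 = (\<Sum>i<n. (x i - y i)\<^sup>2)"
  by (simp add: edist_def L2_set_def sum_nonneg)

lemma edist_nonneg: "0 \<le> edist n x y"
  by (simp add: edist_def)

text \<open>The parallelogram law for the vectors \<open>c - a\<close> and \<open>c - b\<close>,
  whose half sum is \<open>c\<close> minus the midpoint and whose difference has length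
  \<open>edist n a b\<close>.\<close>

lemma edist_midpoint:
  "(edist n c (\<lambda>i\<in>{..<n}. (a i + b i) / 2))\<^sup>2
    = ((edist n c a)\<^sup>2 + (edist n c b)\<^sup>2) / 2 - (edist n a b)\<^sup>2 / 4"
proof -
  have "(\<Sum>i<n. (c i - (\<lambda>i\<in>{..<n}. (a i + b i) / 2) i)\<^sup>2)
    = (\<Sum>i<n. ((c i - a i)\<^sup>2 + (c i - b i)\<^sup>2) / 2 - (a i - b i)\<^sup>2 / 4)"
    by (intro sum.cong) (auto simp: power2_eq_square field_simps)
  also have "\<dots> = ((\<Sum>i<n. (c i - a i)\<^sup>2) + (\<Sum>i<n. (c i - b i)\<^sup>2)) / 2 - (\<Sum>i<n. (a i - b i)\<^sup>2) / 4"
    by (simp only: sum_subtractf sum.distrib sum_divide_distrib[symmetric])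
  finally show ?thesis
    by (simp only: edist_power2)
qed

text \<open>A cube of half side \<open>s\<close> has circumradius \<open>s * sqrt n\<close>, so a
  radius above \<open>sqrt n / 2\<close> leaves room for a concentric cube of side greater than
  1.\<close>

lemma unit_volume_ball_radius:
  assumes "0 < r" and U: "U = eball n c r \<or> U = ecball n c r" and "1 \<le> n"
    and vol: "emeasure (\<Pi>\<^sub>M i\<in>{..<n}. lborel) U = 1"
  shows "4 * r\<^sup>2 \<le> n"
proof (rule ccontr)
  assume "\<not> 4 * r\<^sup>2 \<le> n"
  then have "sqrt n / 2 < r"
    using \<open>0 < r\<close> real_less_rsqrt real_sqrt_less_mono[of n "4 * r\<^sup>2"] by (simp add: real_sqrt_mult)
  \<comment> \<open>The circumradius \<open>q\<close> is strictly below \<open>r\<close>, so the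
    closed cube also fits into the open ball.\<close>
  then obtain q where q: "sqrt n / 2 < q" "q < r" using dense by blast
  define s where "s = q / sqrt n"
  have s: "1 < 2 * s" "s * sqrt n = q"
    using q \<open>1 \<le> n\<close> by (auto simp: s_def field_simps)
  interpret product_sigma_finite "\<lambda>_. lborel :: real measure" by standard
  let ?C = "\<Pi>\<^sub>E i\<in>{..<n}. {c i - s..c i + s}"
  have "emeasure (\<Pi>\<^sub>M i\<in>{..<n}. lborel) ?C = (\<Prod>i<n. emeasure lborel {c i - s..c i + s})"
    by (rule emeasure_PiM) auto
  also have "\<dots> = ennreal ((2 * s) ^ n)"
    using s by (simp add: ennreal_power)
  finally have vC: "emeasure (\<Pi>\<^sub>M i\<in>{..<n}. lborel) ?C = ennreal ((2 * s) ^ n)" .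
  have "?C \<subseteq> U"
  proof
    fix x assume x: "x \<in> ?C"
    have "(edist n c x)\<^sup>2 \<le> (\<Sum>i<n. s\<^sup>2)"
      unfolding edist_power2 using x by (intro sum_mono) (auto simp: PiE_iff abs_le_square_iff[symmetric] abs_le_iff Ball_def)
    also have "\<dots> = q\<^sup>2"
      unfolding s(2)[symmetric] by (simp add: power_mult_distrib)
    finally have "edist n c x \<le> q"
      by (rule power2_le_imp_le) (use q in \<open>auto intro: order_trans[of _ "sqrt n / 2"]\<close>)
    then show "x \<in> U"
      using U q x unfolding eball_def ecball_def Rn_def by (auto simp: PiE_iff)
  qed
  then have "ennreal ((2 * s) ^ n) \<le> 1"
    unfolding vC[symmetric] vol[symmetric]
    \<comment> \<open>Measurability of \<open>U\<close> follows from its measure being 1, since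
      \<open>emeasure\<close> is 0 outside the sigma-algebra.\<close>
    using emeasure_notin_sets[of U "\<Pi>\<^sub>M i\<in>{..<n}. lborel"] vol by (intro emeasure_mono) auto
  then have "(2 * s) ^ n \<le> 1" by (simp add: ennreal_le_1)
  moreover have "1 < (2 * s) ^ n" using s \<open>1 \<le> n\<close> by (intro one_less_power) auto
  ultimately show False by simp
qed

section \<open>Volumes of separated subsets of a ball\<close>

text \<open>Prekopa-Leindler for the indicators of \<open>A\<close>, \<open>B\<close> and the shrunk
  ball \<open>H\<close>, which contains all midpoints.\<close>

theorem ball_separated_volume:
  assumes "0 < R" and U: "U = eball n c R \<or> U = ecball n c R"
    and sets: "U \<in> sets (\<Pi>\<^sub>M i\<in>{..<n}. lborel)" "A \<in> sets (\<Pi>\<^sub>M i\<in>{..<n}. lborel)" "B \<in> sets (\<Pi>\<^sub>M i\<in>{..<n}. lborel)"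
    and sub: "A \<subseteq> U" "B \<subseteq> U" and "0 \<le> d"
    and sep: "\<And>a b. a \<in> A \<Longrightarrow> b \<in> B \<Longrightarrow> d \<le> edist n a b"
  shows "emeasure (\<Pi>\<^sub>M i\<in>{..<n}. lborel) A * emeasure (\<Pi>\<^sub>M i\<in>{..<n}. lborel) B
    \<le> (ennreal (exp (- (n * d\<^sup>2 / (8 * R\<^sup>2)))) * emeasure (\<Pi>\<^sub>M i\<in>{..<n}. lborel) U)\<^sup>2"
proof -
  let ?M = "\<Pi>\<^sub>M i\<in>{..<n}. lborel :: real measure"
  \<comment> \<open>The parallelogram law suggests the factor
    \<open>sqrt (1 - d\<^sup>2 / (4 * R\<^sup>2))\<close>. The exponential dominates it, is positive
    for every \<open>d\<close>, and has the factor of the claim as its \<open>n\<close>-th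
    power.\<close>
  define l where "l = exp (- (d\<^sup>2 / (8 * R\<^sup>2)))"
  have l0: "0 < l" by (simp add: l_def)
  have "l\<^sup>2 = exp (- (d\<^sup>2 / (4 * R\<^sup>2)))"
    by (simp add: l_def power2_eq_square exp_add[symmetric])
  then have "1 - d\<^sup>2 / (4 * R\<^sup>2) \<le> l\<^sup>2"
    using exp_ge_add_one_self[of "- (d\<^sup>2 / (4 * R\<^sup>2))"] by simp
  then have "R\<^sup>2 * (1 - d\<^sup>2 / (4 * R\<^sup>2)) \<le> R\<^sup>2 * l\<^sup>2" by (intro mult_left_mono) auto
  then have l2: "R\<^sup>2 - d\<^sup>2 / 4 \<le> (l * R)\<^sup>2"
    using \<open>0 < R\<close> by (simp add: power_mult_distrib right_diff_distrib mult.commute)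
  \<comment> \<open>\<open>S\<close> is the dilation about \<open>c\<close> by \<open>1 / l\<close>.
    As its preimage of \<open>U\<close>, \<open>H\<close> is the ball shrunk by \<open>l\<close>,
    and its measurability is immediate.\<close>
  define S where "S x = (\<lambda>i\<in>{..<n}. c i - c i / l + x i / l)" for x :: "nat \<Rightarrow> real"
  define H where "H = S -` U \<inter> space ?M"
  have "S \<in> ?M \<rightarrow>\<^sub>M ?M"
    unfolding S_def by measurable
  then have Hs: "H \<in> sets ?M"
    unfolding H_def using sets(1) by (rule measurable_sets)
  have SR: "S x \<in> Rn n" for x
    by (simp add: S_def Rn_def)
  have dS: "edist n c (S x) = edist n c x / l" for x
  proof (rule power2_eq_imp_eq)
    have "(\<Sum>i<n. (c i - S x i)\<^sup>2) = (\<Sum>i<n. (c i - x i)\<^sup>2 / l\<^sup>2)"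
      by (intro sum.cong) (simp_all add: S_def power_divide[symmetric] diff_divide_distrib power2_commute)
    then show "(edist n c (S x))\<^sup>2 = (edist n c x / l)\<^sup>2"
      by (simp add: edist_power2 power_divide sum_divide_distrib)
  qed (use l0 in \<open>auto simp: edist_nonneg\<close>)
  have mid: "(\<lambda>i\<in>{..<n}. (a i + b i) / 2) \<in> H" if "a \<in> A" "b \<in> B" for a b
  proof -
    let ?m = "\<lambda>i\<in>{..<n}. (a i + b i) / 2"
    have ab: "a \<in> U" "b \<in> U" using that sub by auto
    have "d\<^sup>2 \<le> (edist n a b)\<^sup>2" using sep[OF that] \<open>0 \<le> d\<close> by (rule power_mono)
    then have m: "(edist n c ?m)\<^sup>2 \<le> ((edist n c a)\<^sup>2 + (edist n c b)\<^sup>2) / 2 - d\<^sup>2 / 4"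
      by (simp add: edist_midpoint)
    have "S ?m \<in> U"
      using U
    proof
      assume U: "U = eball n c R"
      then have "(edist n c a)\<^sup>2 < R\<^sup>2" "(edist n c b)\<^sup>2 < R\<^sup>2"
        using ab by (auto simp: eball_def edist_nonneg intro!: power_strict_mono)
      then have "(edist n c ?m)\<^sup>2 < (l * R)\<^sup>2"
        by (intro le_less_trans[OF m] less_le_trans[OF _ l2]) simp
      then have "edist n c ?m < l * R" by (rule power2_less_imp_less) (use l0 \<open>0 < R\<close> in auto)
      then show ?thesis using U l0 SR by (simp add: eball_def dS field_simps)
    next
      assume U: "U = ecball n c R"
      then have "(edist n c a)\<^sup>2 \<le> R\<^sup>2" "(edist n c b)\<^sup>2 \<le> R\<^sup>2"
        using ab by (auto simp: ecball_def edist_nonneg intro!: power_mono)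
      then have "(edist n c ?m)\<^sup>2 \<le> (l * R)\<^sup>2"
        by (intro order_trans[OF m] order_trans[OF _ l2]) simp
      then have "edist n c ?m \<le> l * R" by (rule power2_le_imp_le) (use l0 \<open>0 < R\<close> in auto)
      then show ?thesis using U l0 SR by (simp add: ecball_def dS field_simps)
    qed
    then show ?thesis by (simp add: H_def space_PiM)
  qed
  have "emeasure ?M H = (\<integral>\<^sup>+x. indicator H x \<partial>?M)"
    using Hs by simp
  \<comment> \<open>The substitution is the inverse of \<open>S\<close>, which carries
    \<open>U\<close> onto \<open>H\<close> and has Jacobian \<open>l ^ n\<close>.\<close>
  also have "\<dots> = ennreal (l ^ card {..<n}) * (\<integral>\<^sup>+x. indicator H (\<lambda>i\<in>{..<n}. (c i - l * c i) + l * x i) \<partial>?M)"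
    using l0 Hs by (intro nn_integral_PiM_affine) auto
  also have "(\<integral>\<^sup>+x. indicator H (\<lambda>i\<in>{..<n}. (c i - l * c i) + l * x i) \<partial>?M) = (\<integral>\<^sup>+x. indicator U x \<partial>?M)"
  proof (rule nn_integral_cong)
    fix x assume "x \<in> space ?M"
    then have "S (\<lambda>i\<in>{..<n}. (c i - l * c i) + l * x i) = x"
      using l0 by (auto simp: S_def space_PiM PiE_iff extensional_def fun_eq_iff field_simps)
    then show "indicator H (\<lambda>i\<in>{..<n}. (c i - l * c i) + l * x i) = (indicator U x :: ennreal)"
      by (simp add: H_def indicator_def space_PiM)
  qed
  also have "\<dots> = emeasure ?M U" using sets by simp
  also have "l ^ card {..<n} = exp (- (n * d\<^sup>2 / (8 * R\<^sup>2)))"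
    by (simp add: l_def exp_of_nat_mult[symmetric])
  finally have vH: "emeasure ?M H = ennreal (exp (- (n * d\<^sup>2 / (8 * R\<^sup>2)))) * emeasure ?M U" .
  have "(\<integral>\<^sup>+x. indicator A x \<partial>?M) * (\<integral>\<^sup>+x. indicator B x \<partial>?M) \<le> (\<integral>\<^sup>+x. indicator H x \<partial>?M)\<^sup>2"
    using sets Hs mid by (intro prekopa_leindler_midpoint) (auto simp: indicator_def)
  then show ?thesis
    using sets Hs vH by simp
qed

section \<open>Passage to Lebesgue measurable sets and the uniform bound\<close>

text \<open>\<open>main_part\<close> drops only a piece of a null set. Approximation from inside is
  the right direction, since subsets of separated sets remain separated.\<close>

lemma completion_inner_set:
  assumes "A \<in> sets (completion M)"
  obtains A' where "A' \<in> sets M" "A' \<subseteq> A" "emeasure M A' = emeasure (completion M) A"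
proof
  show "main_part M A \<in> sets M" "main_part M A \<subseteq> A" "emeasure M (main_part M A) = emeasure (completion M) A"
    using assms main_part_null_part_Un[OF assms] by (blast | simp add: emeasure_completion)+
qed

theorem mainTheorem1:
  "\<forall>\<epsilon>::real. 0 < \<epsilon> \<and> \<epsilon> < 1 \<longrightarrow>
    (\<exists>D::real. \<forall>n\<ge>1. \<forall>U A B.
      is_ball n U \<and> emeasure (lebesgue_n n) U = 1 \<and>
      A \<subseteq> U \<and> B \<subseteq> U \<and>
      A \<in> sets (lebesgue_n n) \<and> B \<in> sets (lebesgue_n n) \<and>
      emeasure (lebesgue_n n) A = ennreal \<epsilon> \<and> emeasure (lebesgue_n n) B = ennreal \<epsilon> \<longrightarrow>
      set_edist n A B \<le> D)"
proof (intro allI impI exI, elim conjE)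
  fix \<epsilon> :: real and n :: nat and U A B :: "(nat \<Rightarrow> real) set"
  assume \<epsilon>: "0 < \<epsilon>" "\<epsilon> < 1" and n: "1 \<le> n" and ball: "is_ball n U"
    and vol: "emeasure (lebesgue_n n) U = 1"
    and AB: "A \<subseteq> U" "B \<subseteq> U" "A \<in> sets (lebesgue_n n)" "B \<in> sets (lebesgue_n n)"
      "emeasure (lebesgue_n n) A = ennreal \<epsilon>" "emeasure (lebesgue_n n) B = ennreal \<epsilon>"
  let ?M = "\<Pi>\<^sub>M i\<in>{..<n}. lborel :: real measure"
  obtain c r where r: "0 < r" "U = eball n c r \<or> U = ecball n c r"
    using ball unfolding is_ball_def by blast
  have Us: "U \<in> sets ?M" using ball by (rule is_ball_sets)
  then have vol': "emeasure ?M U = 1" using vol unfolding lebesgue_n_def by simp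
  obtain A' where A': "A' \<in> sets ?M" "A' \<subseteq> A" "emeasure ?M A' = ennreal \<epsilon>"
    using completion_inner_set[of A ?M] AB unfolding lebesgue_n_def by metis
  obtain B' where B': "B' \<in> sets ?M" "B' \<subseteq> B" "emeasure ?M B' = ennreal \<epsilon>"
    using completion_inner_set[of B ?M] AB unfolding lebesgue_n_def by metis
  define d where "d = set_edist n A B"
  \<comment> \<open>Positive volume makes the infimum range over a nonempty set, as
    \<open>cInf_greatest\<close> requires.\<close>
  have "A \<noteq> {}" "B \<noteq> {}" using AB \<epsilon> by auto
  then have d0: "0 \<le> d"
    unfolding d_def set_edist_def by (intro cInf_greatest) (auto simp: edist_nonneg)
  have sep: "d \<le> edist n a b" if "a \<in> A'" "b \<in> B'" for a b
    unfolding d_def set_edist_def using that A' B'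
    by (intro cInf_lower) (auto intro!: bdd_belowI[of _ 0] simp: edist_nonneg)
  have "ennreal \<epsilon> * ennreal \<epsilon> \<le> (ennreal (exp (- (n * d\<^sup>2 / (8 * r\<^sup>2)))))\<^sup>2"
    using ball_separated_volume[OF r Us A'(1) B'(1) _ _ d0 sep] A' B' AB vol' by auto
  then have "\<epsilon>\<^sup>2 \<le> (exp (- (n * d\<^sup>2 / (8 * r\<^sup>2))))\<^sup>2"
    using \<epsilon> by (simp add: power2_eq_square ennreal_mult[symmetric])
  then have "\<epsilon> \<le> exp (- (n * d\<^sup>2 / (8 * r\<^sup>2)))"
    by (rule power2_le_imp_le) simp
  then have "ln \<epsilon> \<le> - (n * d\<^sup>2 / (8 * r\<^sup>2))"
    using \<epsilon> by (metis exp_le_cancel_iff exp_ln)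
  \<comment> \<open>Here the dimension cancels: \<open>4 * r\<^sup>2 \<le> n\<close> bounds
    \<open>n / (8 * r\<^sup>2)\<close> below by 1/2.\<close>
  moreover have "d\<^sup>2 / 2 \<le> n * d\<^sup>2 / (8 * r\<^sup>2)"
    using mult_right_mono[OF unit_volume_ball_radius[OF r n vol'], of "d\<^sup>2"] r
    by (simp add: field_simps)
  ultimately have "d\<^sup>2 \<le> - 2 * ln \<epsilon>" by simp
  \<comment> \<open>This fixes the witness left open by \<open>exI\<close>. It was introduced before
    \<open>n\<close>, \<open>U\<close>, \<open>A\<close> and \<open>B\<close>, so it can depend on
    \<open>\<epsilon>\<close> alone.\<close>
  then show "set_edist n A B \<le> sqrt (- 2 * ln \<epsilon>)"
    unfolding d_def[symmetric] by (rule real_le_rsqrt)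
qed

end
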